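(* The second cohomology group of the extended Schrödinger-Virasoro Lie algebra $\widetilde{\mathfrak{sv}}$ with trivial coefficients is three-dimensional: $\dim_{\mathbb{C}} H^2(\widetilde{\mathfrak{sv}},\mathbb{C})=3$.
   Context: The extended Schrödinger-Virasoro Lie algebra $\widetilde{\mathfrak{sv}}$ is the complex Lie algebra with basis $\{L_n, M_n, N_n, Y_{n+\frac12} \mid n\in\mathbb{Z}\}$ and brackets, for all $m,n\in\mathbb{Z}$: $[L_m,L_n]=(n-m)L_{m+n}$, $[M_m,M_n]=0$, $[N_m,N_n]=0$, $[Y_{m+\frac12},Y_{n+\frac12}]=(m-n)M_{m+n+1}$, $[L_m,M_n]=nM_{m+n}$, $[L_m,N_n]=nN_{m+n}$, $[L_m,Y_{n+\frac12}]=\left(n+\frac{1-m}{2}\right)Y_{m+n+\frac12}$, $[N_m,M_n]=2M_{m+n}$, $[N_m,Y_{n+\frac12}]=Y_{m+n+\frac12}$, $[M_m,Y_{n+\frac12}]=0$. For a complex Lie algebra $\mathfrak{g}$, a 2-cocycle is a bilinear function $\psi:\mathfrak{g}\times\mathfrak{g}\to\mathbb{C}$ with $\psi(x,y)=-\psi(y,x)$ and $\psi([x,y],z)+\psi([y,z],x)+\psi([z,x],y)=0$ for all $x,y,z\in\mathfrak{g}$. A 2-coboundary is a 2-cocycle of the form $\psi_f(x,y)=f([x,y])$ for a linear function $f:\mathfrak{g}\to\mathbb{C}$. $H^2(\mathfrak{g},\mathbb{C})$ is the quotient of the space of 2-cocycles by the space of 2-coboundaries. *)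

theory Defs
  imports Complex_Main
begin

class complex_vector = ab_group_add +
  fixes scaleC :: "complex \<Rightarrow> 'a \<Rightarrow> 'a"  (infixr "*\<^sub>C" 75)
  assumes scaleC_add_right: "a *\<^sub>C (x + y) = a *\<^sub>C x + a *\<^sub>C y"
    and scaleC_add_left: "(a + b) *\<^sub>C x = a *\<^sub>C x + b *\<^sub>C x"
    and scaleC_scaleC: "a *\<^sub>C b *\<^sub>C x = (a * b) *\<^sub>C x"
    and scaleC_one: "1 *\<^sub>C x = x"

interpretation complex_vector: vector_space "scaleC :: complex \<Rightarrow> 'a \<Rightarrow> 'a::complex_vector"
  by unfold_locales (rule scaleC_add_right scaleC_add_left scaleC_scaleC scaleC_one)+

class complex_lie_algebra = complex_vector +
  fixes bracket :: "'a \<Rightarrow> 'a \<Rightarrow> 'a"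
  assumes bracket_add_left: "bracket (x + y) z = bracket x z + bracket y z"
    and bracket_add_right: "bracket x (y + z) = bracket x y + bracket x z"
    and bracket_scale_left: "bracket (a *\<^sub>C x) y = a *\<^sub>C bracket x y"
    and bracket_scale_right: "bracket x (a *\<^sub>C y) = a *\<^sub>C bracket x y"
    and bracket_self: "bracket x x = 0"
    and jacobi: "bracket (bracket x y) z + bracket (bracket y z) x + bracket (bracket z x) y = 0"

definition clinear_form :: "('a::complex_vector \<Rightarrow> complex) \<Rightarrow> bool"
  where "clinear_form f \<longleftrightarrow> Vector_Spaces.linear scaleC (*) f"

definition cbilinear_form :: "('a::complex_vector \<Rightarrow> 'a \<Rightarrow> complex) \<Rightarrow> bool"
  where "cbilinear_form \<psi> \<longleftrightarrow>
    (\<forall>x. clinear_form (\<psi> x)) \<and> (\<forall>y. clinear_form (\<lambda>x. \<psi> x y))"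

definition cocycle2 :: "('a::complex_lie_algebra \<Rightarrow> 'a \<Rightarrow> complex) \<Rightarrow> bool"
  where "cocycle2 \<psi> \<longleftrightarrow> cbilinear_form \<psi> \<and> (\<forall>x y. \<psi> x y = - \<psi> y x) \<and>
    (\<forall>x y z. \<psi> (bracket x y) z + \<psi> (bracket y z) x + \<psi> (bracket z x) y = 0)"

definition coboundary2 :: "('a::complex_lie_algebra \<Rightarrow> 'a \<Rightarrow> complex) \<Rightarrow> bool"
  where "coboundary2 \<psi> \<longleftrightarrow> cocycle2 \<psi> \<and>
    (\<exists>f. clinear_form f \<and> \<psi> = (\<lambda>x y. f (bracket x y)))"

definition cohomologous2 ::
    "('a::complex_lie_algebra \<Rightarrow> 'a \<Rightarrow> complex) \<Rightarrow> ('a \<Rightarrow> 'a \<Rightarrow> complex) \<Rightarrow> bool"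
  where "cohomologous2 \<psi> \<phi> \<longleftrightarrow>
    cocycle2 \<psi> \<and> cocycle2 \<phi> \<and> coboundary2 (\<lambda>x y. \<psi> x y - \<phi> x y)"

lemma clinear_form_iff:
  "clinear_form f \<longleftrightarrow> (\<forall>x y. f (x + y) = f x + f y) \<and> (\<forall>a x. f (a *\<^sub>C x) = a * f x)"
  unfolding clinear_form_def Vector_Spaces.linear_iff
  by (auto simp: complex_vector.vector_space_axioms vector_space_def algebra_simps)

lemma cocycle2_zero: "cocycle2 (\<lambda>x y. 0)"
  by (simp add: cocycle2_def cbilinear_form_def clinear_form_iff)

lemma cocycle2_combination:
  assumes "cocycle2 \<psi>" "cocycle2 \<phi>"
  shows "cocycle2 (\<lambda>x y. a * \<psi> x y + b * \<phi> x y)"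
  unfolding cocycle2_def
proof (intro conjI allI)
  have "cbilinear_form \<psi>" "cbilinear_form \<phi>"
    using assms by (simp_all only: cocycle2_def)
  then show "cbilinear_form (\<lambda>x y. a * \<psi> x y + b * \<phi> x y)"
    by (simp add: cbilinear_form_def clinear_form_iff algebra_simps)
  fix x y z
  have "\<psi> x y = - \<psi> y x" "\<phi> x y = - \<phi> y x"
    using assms unfolding cocycle2_def by blast+
  then show "a * \<psi> x y + b * \<phi> x y = - (a * \<psi> y x + b * \<phi> y x)"
    by simp
  have "\<psi> (bracket x y) z + \<psi> (bracket y z) x + \<psi> (bracket z x) y = 0"
      "\<phi> (bracket x y) z + \<phi> (bracket y z) x + \<phi> (bracket z x) y = 0"
    using assms unfolding cocycle2_def by blast+
  then have "a * (\<psi> (bracket x y) z + \<psi> (bracket y z) x + \<psi> (bracket z x) y) +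
      b * (\<phi> (bracket x y) z + \<phi> (bracket y z) x + \<phi> (bracket z x) y) = 0"
    by (simp only: mult_zero_right add_0)
  then show "a * \<psi> (bracket x y) z + b * \<phi> (bracket x y) z +
      (a * \<psi> (bracket y z) x + b * \<phi> (bracket y z) x) +
      (a * \<psi> (bracket z x) y + b * \<phi> (bracket z x) y) = 0"
    by (simp add: algebra_simps)
qed

lemma coboundary2_combination:
  assumes "coboundary2 \<psi>" "coboundary2 \<phi>"
  shows "coboundary2 (\<lambda>x y. a * \<psi> x y + b * \<phi> x y)"
proof -
  obtain f g where "clinear_form f" "\<psi> = (\<lambda>x y. f (bracket x y))"
      "clinear_form g" "\<phi> = (\<lambda>x y. g (bracket x y))"
    using assms by (auto simp: coboundary2_def)
  then have "clinear_form (\<lambda>x. a * f x + b * g x) \<and>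
      (\<lambda>x y. a * \<psi> x y + b * \<phi> x y) = (\<lambda>x y. a * f (bracket x y) + b * g (bracket x y))"
    by (auto simp: clinear_form_iff algebra_simps)
  then show ?thesis
    using assms cocycle2_combination[of \<psi> \<phi> a b] unfolding coboundary2_def
    by (intro conjI exI[of _ "\<lambda>x. a * f x + b * g x"]) auto
qed

lemma coboundary2_zero: "coboundary2 (\<lambda>x y. 0)"
  unfolding coboundary2_def clinear_form_iff
  by (intro conjI cocycle2_zero exI[of _ "\<lambda>x. 0"]) simp_all

lemma cohomologous2_combination:
  assumes "cohomologous2 \<psi> \<psi>'" "cohomologous2 \<phi> \<phi>'"
  shows "cohomologous2 (\<lambda>x y. a * \<psi> x y + b * \<phi> x y) (\<lambda>x y. a * \<psi>' x y + b * \<phi>' x y)"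
  using assms cocycle2_combination[of \<psi> \<phi> a b] cocycle2_combination[of \<psi>' \<phi>' a b]
    coboundary2_combination[of "\<lambda>x y. \<psi> x y - \<psi>' x y" "\<lambda>x y. \<phi> x y - \<phi>' x y" a b]
  by (simp add: cohomologous2_def algebra_simps)

lemma part_equivp_cohomologous2: "part_equivp cohomologous2"
proof (rule part_equivpI)
  show "\<exists>\<psi>::'a \<Rightarrow> 'a \<Rightarrow> complex. cohomologous2 \<psi> \<psi>"
    using cocycle2_zero coboundary2_zero by (force simp: cohomologous2_def)
  show "symp (cohomologous2 :: ('a \<Rightarrow> 'a \<Rightarrow> complex) \<Rightarrow> _)"
  proof (rule sympI)
    fix \<psi> \<phi> :: "'a \<Rightarrow> 'a \<Rightarrow> complex"
    assume "cohomologous2 \<psi> \<phi>"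
    then show "cohomologous2 \<phi> \<psi>"
      using coboundary2_combination[of "\<lambda>x y. \<psi> x y - \<phi> x y" "\<lambda>x y. 0" "-1" 0]
      by (auto simp: cohomologous2_def coboundary2_zero)
  qed
  show "transp (cohomologous2 :: ('a \<Rightarrow> 'a \<Rightarrow> complex) \<Rightarrow> _)"
  proof (rule transpI)
    fix \<psi> \<phi> \<chi> :: "'a \<Rightarrow> 'a \<Rightarrow> complex"
    assume "cohomologous2 \<psi> \<phi>" "cohomologous2 \<phi> \<chi>"
    then show "cohomologous2 \<psi> \<chi>"
      using coboundary2_combination[of "\<lambda>x y. \<psi> x y - \<phi> x y" "\<lambda>x y. \<phi> x y - \<chi> x y" 1 1]
      by (auto simp: cohomologous2_def)
  qed
qed

text \<open>The quotient is partial: its elements are the classes of 2-cocycles only, so the type is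
  the space of 2-cocycles modulo the 2-coboundaries.\<close>

quotient_type (overloaded) 'a H2 = "'a::complex_lie_algebra \<Rightarrow> 'a \<Rightarrow> complex" / partial: cohomologous2
  by (rule part_equivp_cohomologous2)

instantiation H2 :: (complex_lie_algebra) complex_vector
begin

lift_definition zero_H2 :: "'a H2" is "\<lambda>x y. 0"
  using cocycle2_zero coboundary2_zero by (simp add: cohomologous2_def)

lift_definition plus_H2 :: "'a H2 \<Rightarrow> 'a H2 \<Rightarrow> 'a H2" is "\<lambda>\<psi> \<phi> x y. \<psi> x y + \<phi> x y"
  using cohomologous2_combination[where a = 1 and b = 1] by simp

lift_definition minus_H2 :: "'a H2 \<Rightarrow> 'a H2 \<Rightarrow> 'a H2" is "\<lambda>\<psi> \<phi> x y. \<psi> x y - \<phi> x y"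
  using cohomologous2_combination[where a = 1 and b = "-1"] by simp

lift_definition uminus_H2 :: "'a H2 \<Rightarrow> 'a H2" is "\<lambda>\<psi> x y. - \<psi> x y"
  using cohomologous2_combination[where a = "-1" and b = 0] by fastforce

lift_definition scaleC_H2 :: "complex \<Rightarrow> 'a H2 \<Rightarrow> 'a H2" is "\<lambda>a \<psi> x y. a * \<psi> x y"
  using cohomologous2_combination[where b = 0] by fastforce

instance
proof
  fix a b c :: "'a H2" and r s :: complex
  have refl: "cohomologous2 \<psi> \<psi>" if "cohomologous2 \<psi> \<psi>'" for \<psi> \<psi>' :: "'a \<Rightarrow> 'a \<Rightarrow> complex"
    using that coboundary2_zero by (simp add: cohomologous2_def)
  note comb = cohomologous2_combination
  show "a + b + c = a + (b + c)"
    apply transfer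
    subgoal for f g h using comb[OF comb[of f f g g 1 1], of h h 1 1] by (simp add: add.assoc)
    done
  show "a + b = b + a"
    apply transfer
    subgoal for f g using comb[of f f g g 1 1] by (simp add: add.commute)
    done
  show "0 + a = a"
    by transfer simp
  show "- a + a = 0"
    by transfer (simp add: cohomologous2_def cocycle2_zero coboundary2_zero)
  show "a - b = a + - b"
    apply transfer
    subgoal for f g using comb[of f f g g 1 "-1"] by simp
    done
  show "r *\<^sub>C (a + b) = r *\<^sub>C a + r *\<^sub>C b"
    apply transfer
    subgoal for r f g using comb[of f f g g r r] by (simp add: algebra_simps)
    done
  show "(r + s) *\<^sub>C a = r *\<^sub>C a + s *\<^sub>C a"
    apply transfer
    subgoal for r s f using comb[of f f f f r s] by (simp add: algebra_simps)
    done
  show "r *\<^sub>C s *\<^sub>C a = (r * s) *\<^sub>C a"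
    apply transfer
    subgoal for r s f using comb[of f f f f "r * s" 0] by (simp add: algebra_simps)
    done
  show "1 *\<^sub>C a = a"
    by transfer simp
qed

end

text \<open>The basis of the extended Schroedinger-Virasoro algebra. The index \<open>Y n\<close> stands for
  the basis vector $Y_{n+1/2}$.\<close>

datatype sv_index = L int | M int | N int | Y int

typedef sv = "{f :: sv_index \<Rightarrow> complex. finite {i. f i \<noteq> 0}}"
  morphisms coeff Abs_sv
  by (rule exI[of _ "\<lambda>_. 0"]) simp

setup_lifting type_definition_sv

instantiation sv :: complex_vector
begin

lift_definition zero_sv :: sv is "\<lambda>i. 0" by simp

lift_definition plus_sv :: "sv \<Rightarrow> sv \<Rightarrow> sv" is "\<lambda>f g i. f i + g i"
  by (erule (1) finite_subset[OF _ finite_UnI, rotated]) auto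

lift_definition minus_sv :: "sv \<Rightarrow> sv \<Rightarrow> sv" is "\<lambda>f g i. f i - g i"
  by (erule (1) finite_subset[OF _ finite_UnI, rotated]) auto

lift_definition uminus_sv :: "sv \<Rightarrow> sv" is "\<lambda>f i. - f i" by simp

lift_definition scaleC_sv :: "complex \<Rightarrow> sv \<Rightarrow> sv" is "\<lambda>a f i. a * f i"
  by (erule finite_subset[rotated]) auto

instance
  by standard (transfer; auto simp: algebra_simps)+

end

lift_definition gen :: "sv_index \<Rightarrow> sv" is "\<lambda>i j. if j = i then 1 else 0"
  by simp

definition supp :: "sv \<Rightarrow> sv_index set"
  where "supp x = {i. coeff x i \<noteq> 0}"

definition lin_ext :: "(sv_index \<Rightarrow> sv) \<Rightarrow> sv \<Rightarrow> sv"
  where "lin_ext g x = (\<Sum>i\<in>supp x. coeff x i *\<^sub>C g i)"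

text \<open>The last six equations are the mixed brackets with the arguments in the opposite order,
  determined by antisymmetry.\<close>

fun bracket_gen :: "sv_index \<Rightarrow> sv_index \<Rightarrow> sv" where
  "bracket_gen (L m) (L n) = of_int (n - m) *\<^sub>C gen (L (m + n))"
| "bracket_gen (M m) (M n) = 0"
| "bracket_gen (N m) (N n) = 0"
| "bracket_gen (Y m) (Y n) = of_int (m - n) *\<^sub>C gen (M (m + n + 1))"
| "bracket_gen (L m) (M n) = of_int n *\<^sub>C gen (M (m + n))"
| "bracket_gen (L m) (N n) = of_int n *\<^sub>C gen (N (m + n))"
| "bracket_gen (L m) (Y n) = (of_int n + (1 - of_int m) / 2) *\<^sub>C gen (Y (m + n))"
| "bracket_gen (N m) (M n) = 2 *\<^sub>C gen (M (m + n))"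
| "bracket_gen (N m) (Y n) = gen (Y (m + n))"
| "bracket_gen (M m) (Y n) = 0"
| "bracket_gen (M n) (L m) = - (of_int n *\<^sub>C gen (M (m + n)))"
| "bracket_gen (N n) (L m) = - (of_int n *\<^sub>C gen (N (m + n)))"
| "bracket_gen (Y n) (L m) = - ((of_int n + (1 - of_int m) / 2) *\<^sub>C gen (Y (m + n)))"
| "bracket_gen (M n) (N m) = - (2 *\<^sub>C gen (M (m + n)))"
| "bracket_gen (Y n) (N m) = - gen (Y (m + n))"
| "bracket_gen (Y n) (M m) = 0"

lemma finite_supp: "finite (supp x)"
  unfolding supp_def using coeff[of x] by simp

lemma coeff_simps:
  "coeff 0 i = 0" "coeff (x + y) i = coeff x i + coeff y i" "coeff (a *\<^sub>C x) i = a * coeff x i"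
  "coeff (- x) i = - coeff x i" "coeff (x - y) i = coeff x i - coeff y i"
  "coeff (gen j) i = (if i = j then 1 else 0)"
  by (transfer; simp)+

lemma coeff_sum: "coeff (sum h A) i = (\<Sum>a\<in>A. coeff (h a) i)"
  by (induction A rule: infinite_finite_induct) (auto simp: coeff_simps)

lemma lin_ext_superset:
  assumes "finite S" "supp x \<subseteq> S"
  shows "lin_ext g x = (\<Sum>i\<in>S. coeff x i *\<^sub>C g i)"
  unfolding lin_ext_def using assms by (intro sum.mono_neutral_left) (auto simp: supp_def)

lemma lin_ext_add: "lin_ext g (x + y) = lin_ext g x + lin_ext g y"
proof -
  let ?S = "supp x \<union> supp y"
  have "supp (x + y) \<subseteq> ?S" by (auto simp: supp_def coeff_simps)
  then show ?thesis
    by (simp add: lin_ext_superset[of ?S] finite_supp coeff_simps sum.distrib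
        complex_vector.scale_left_distrib)
qed

lemma lin_ext_scale: "lin_ext g (a *\<^sub>C x) = a *\<^sub>C lin_ext g x"
proof -
  have "supp (a *\<^sub>C x) \<subseteq> supp x" by (auto simp: supp_def coeff_simps)
  then show ?thesis
    by (simp add: lin_ext_superset[of "supp x"] finite_supp coeff_simps
        complex_vector.scale_sum_right)
qed

lemma lin_ext_gen: "lin_ext g (gen i) = g i"
  by (subst lin_ext_superset[of "{i}"]) (auto simp: supp_def coeff_simps split: if_splits)

lemma lin_ext_gen_self: "lin_ext gen x = x"
proof -
  have "coeff (lin_ext gen x) i = coeff x i" for i
    by (simp add: lin_ext_def coeff_sum coeff_simps finite_supp if_distrib sum.delta' cong: if_cong)
      (simp add: supp_def)
  then show ?thesis by (metis coeff_inject ext)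
qed

lemma lin_ext_fun_add: "lin_ext (\<lambda>i. g i + h i) x = lin_ext g x + lin_ext h x"
  by (simp add: lin_ext_def complex_vector.scale_right_distrib sum.distrib)

lemma lin_ext_fun_scale: "lin_ext (\<lambda>i. a *\<^sub>C g i) x = a *\<^sub>C lin_ext g x"
  by (simp add: lin_ext_def complex_vector.scale_sum_right mult.commute)

lemma sv_induct [case_names gen zero add scale]:
  assumes gen: "\<And>i. P (gen i)" and zero: "P 0"
    and add: "\<And>x y. P x \<Longrightarrow> P y \<Longrightarrow> P (x + y)" and scale: "\<And>a x. P x \<Longrightarrow> P (a *\<^sub>C x)"
  shows "P x"
proof -
  have "P (\<Sum>i\<in>S. coeff x i *\<^sub>C gen i)" for S
    by (induction S rule: infinite_finite_induct) (auto intro: assms)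
  then show ?thesis using lin_ext_gen_self[of x] unfolding lin_ext_def by metis
qed

instantiation sv :: complex_lie_algebra
begin

definition bracket_sv :: "sv \<Rightarrow> sv \<Rightarrow> sv"
  where "bracket_sv x y = lin_ext (\<lambda>i. lin_ext (bracket_gen i) y) x"

instance
proof
  fix x y z :: sv and a :: complex
  show add_left: "bracket (x + y) z = bracket x z + bracket y z" for x y z :: sv
    by (simp add: bracket_sv_def lin_ext_add)
  show add_right: "bracket x (y + z) = bracket x y + bracket x z" for x y z :: sv
    by (simp add: bracket_sv_def lin_ext_add lin_ext_fun_add)
  show scale_left: "bracket (a *\<^sub>C x) y = a *\<^sub>C bracket x y" for x y :: sv and a
    by (simp add: bracket_sv_def lin_ext_scale)
  show scale_right: "bracket x (a *\<^sub>C y) = a *\<^sub>C bracket x y" for x y :: sv and a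
    by (simp add: bracket_sv_def lin_ext_scale lin_ext_fun_scale)
  have gen: "bracket (gen i) (gen j) = bracket_gen i j" for i j
    by (simp add: bracket_sv_def lin_ext_gen)
  have zero_left: "bracket 0 x = 0" and zero_right: "bracket x 0 = 0" for x :: sv
    using add_left[of 0 0 x] add_right[of x 0 0] by simp_all
  have minus_left: "bracket (- x) y = - bracket x y" for x y :: sv
    using add_left[of x "- x" y] zero_left[of y] by (simp add: add_eq_0_iff)
  have diff_left: "bracket (x - y) z = bracket x z - bracket y z" for x y z :: sv
    using add_left[of x "- y" z] minus_left[of y z] by simp
  note bilin = add_left add_right scale_left scale_right zero_left zero_right minus_left diff_left
  have skew_coeff: "coeff (bracket_gen i j + bracket_gen j i) l = 0" for i j l
    by (cases i; cases j) (simp_all add: coeff_simps ac_simps)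
  then have skew_gen: "bracket_gen i j + bracket_gen j i = 0" for i j
    by (metis coeff_inject coeff_simps(1) ext)
  have skew_gen': "bracket (gen i) y + bracket y (gen i) = 0" for i y
  proof (induction y rule: sv_induct)
    case (add x y)
    have "bracket (gen i) (x + y) + bracket (x + y) (gen i) =
      (bracket (gen i) x + bracket x (gen i)) + (bracket (gen i) y + bracket y (gen i))"
      by (simp add: bilin)
    then show ?case using add by simp
  qed (simp_all add: gen skew_gen bilin complex_vector.scale_right_distrib[symmetric])
  have skew: "bracket x y + bracket y x = 0" for x y :: sv
  proof (induction x rule: sv_induct)
    case (add u v)
    have "bracket (u + v) y + bracket y (u + v) =
      (bracket u y + bracket y u) + (bracket v y + bracket y v)"
      by (simp add: bilin)
    then show ?case using add by simp
  qed (simp_all add: skew_gen' bilin complex_vector.scale_right_distrib[symmetric])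
  have "2 *\<^sub>C bracket x x = 0"
    using skew[of x x] complex_vector.scale_left_distrib[of 1 1 "bracket x x"] by simp
  then show "bracket x x = 0" by simp
  define J where
    "J x y z = bracket (bracket x y) z + bracket (bracket y z) x + bracket (bracket z x) y"
    for x y z :: sv
  have J_add: "J (u + v) y z = J u y z + J v y z" "J x (u + v) z = J x u z + J x v z"
    "J x y (u + v) = J x y u + J x y v" for u v x y z
    by (simp_all add: J_def bilin)
  have J_scale: "J (a *\<^sub>C u) y z = a *\<^sub>C J u y z" "J x (a *\<^sub>C u) z = a *\<^sub>C J x u z"
    "J x y (a *\<^sub>C u) = a *\<^sub>C J x y u" for a u x y z
    by (simp_all add: J_def bilin complex_vector.scale_right_distrib)
  have J_zero: "J 0 y z = 0" "J x 0 z = 0" "J x y 0 = 0" for x y z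
    by (simp_all add: J_def bilin)
  have J_coeff: "coeff (J (gen i) (gen j) (gen k)) l = 0" for i j k l
    by (cases i; cases j; cases k; simp add: J_def gen bilin coeff_simps(1-5);
        simp add: field_simps)
  then have J_gen: "J (gen i) (gen j) (gen k) = 0" for i j k
    by (metis coeff_inject coeff_simps(1) ext)
  from J_gen have "J (gen i) (gen j) z = 0" for i j z
    by (induction z rule: sv_induct) (simp_all add: J_add J_scale J_zero)
  then have "J (gen i) y z = 0" for i y z
    by (induction y rule: sv_induct) (simp_all add: J_add J_scale J_zero)
  then have "J x y z = 0" for x y z
    by (induction x rule: sv_induct) (simp_all add: J_add J_scale J_zero)
  then show "bracket (bracket x y) z + bracket (bracket y z) x + bracket (bracket z x) y = 0"
    by (simp add: J_def)
qed

end

lemma bracket_gen_gen: "bracket (gen i) (gen j) = bracket_gen i j"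
  by (simp add: bracket_sv_def lin_ext_gen)

lemma inj_gen: "inj gen"
  by (rule injI) (metis coeff_simps(6) zero_neq_one)

lemma span_gen: "complex_vector.span (range gen) = UNIV"
proof -
  have "x \<in> complex_vector.span (range gen)" for x
    by (induction x rule: sv_induct)
      (auto intro: complex_vector.span_base complex_vector.span_add complex_vector.span_scale
        complex_vector.span_zero)
  then show ?thesis by auto
qed

lemma independent_gen: "complex_vector.independent (range gen)"
proof
  assume "complex_vector.dependent (range gen)"
  then obtain t u w where t: "finite t" "t \<subseteq> range gen" "(\<Sum>v\<in>t. u v *\<^sub>C v) = 0"
    and w: "w \<in> t" "u w \<noteq> 0"
    unfolding complex_vector.dependent_explicit by blast
  obtain i where i: "w = gen i" using t(2) w(1) by blast
  have "coeff v i = (if v = w then 1 else 0)" if "v \<in> t" for v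
    using that t(2) inj_gen by (auto simp: i coeff_simps inj_eq)
  then have "coeff (\<Sum>v\<in>t. u v *\<^sub>C v) i = (\<Sum>v\<in>t. if v = w then u v else 0)"
    unfolding coeff_sum coeff_simps by (intro sum.cong) auto
  also have "\<dots> = u w"
    using t(1) w(1) by simp
  finally show False using t(3) w(2) by (simp add: coeff_simps)
qed

end

theory Submission
  imports Defs
begin

text \<open>If \<open>d\<close> acts diagonally on the basis, a cocycle \<open>\<psi>\<close> satisfies
  \<open>w \<cdot> \<psi>(x, y) = \<psi>(d, [x, y])\<close> on vectors of total \<open>d\<close>-weight \<open>w\<close>, so outside weight \<open>0\<close> it
  agrees with a coboundary \<open>f([x, y])\<close>. Taking for \<open>d\<close> first \<open>N 0\<close> (weights 0 on \<open>L\<close> and \<open>N\<close>, 1 on \<open>Y\<close>, 2 on \<open>M\<close>) and then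
  \<open>L 0\<close>, only the values \<open>\<psi>(L n, L (-n))\<close>, \<open>\<psi>(L n, N (-n))\<close> and \<open>\<psi>(N n, N (-n))\<close> survive.
  The cocycle identity gives recurrences that force them to be \<open>a n^3 + a' n\<close>, \<open>b n^2 + b' n\<close> and
  \<open>c n\<close>, and the values of \<open>f\<close> at \<open>L 0\<close> and \<open>N 0\<close> absorb \<open>a'\<close> and \<open>b'\<close>.\<close>

section \<open>Linear and bilinear forms on finitely supported vectors\<close>

definition form_ext :: "(sv_index \<Rightarrow> complex) \<Rightarrow> sv \<Rightarrow> complex"
  where "form_ext g x = (\<Sum>i\<in>supp x. coeff x i * g i)"

lemma form_ext_superset:
  assumes "finite S" "supp x \<subseteq> S"
  shows "form_ext g x = (\<Sum>i\<in>S. coeff x i * g i)"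
  unfolding form_ext_def using assms by (intro sum.mono_neutral_left) (auto simp: supp_def)

lemma form_ext_add: "form_ext g (x + y) = form_ext g x + form_ext g y"
proof -
  let ?S = "supp x \<union> supp y"
  have "supp (x + y) \<subseteq> ?S" by (auto simp: supp_def coeff_simps)
  then show ?thesis
    by (simp add: form_ext_superset[of ?S] finite_supp coeff_simps sum.distrib distrib_right)
qed

lemma form_ext_scale: "form_ext g (a *\<^sub>C x) = a * form_ext g x"
proof -
  have "supp (a *\<^sub>C x) \<subseteq> supp x" by (auto simp: supp_def coeff_simps)
  then show ?thesis
    by (simp add: form_ext_superset[of "supp x"] finite_supp coeff_simps sum_distrib_left mult.assoc)
qed

lemma clinear_form_ext: "clinear_form (form_ext g)"
  by (simp add: clinear_form_iff form_ext_add form_ext_scale)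

lemma form_ext_gen: "form_ext g (gen i) = g i"
  by (subst form_ext_superset[of "{i}"]) (auto simp: supp_def coeff_simps split: if_splits)

lemma form_ext_fun_add: "form_ext (\<lambda>i. g i + h i) x = form_ext g x + form_ext h x"
  by (simp add: form_ext_def sum.distrib distrib_left)

lemma form_ext_fun_scale: "form_ext (\<lambda>i. a * g i) x = a * form_ext g x"
  by (simp add: form_ext_def sum_distrib_left ac_simps)

lemma clinear_form_zero: "clinear_form f \<Longrightarrow> f 0 = 0"
  using complex_vector.scale_zero_left[of 0] by (metis clinear_form_iff mult_zero_left)

lemma clinear_form_minus: "clinear_form f \<Longrightarrow> f (- x) = - f x"
  by (metis add_eq_0_iff add.right_inverse clinear_form_iff clinear_form_zero)

lemmas clinear_form_simps = clinear_form_zero clinear_form_minus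
  clinear_form_iff[THEN iffD1, THEN conjunct1, rule_format]
  clinear_form_iff[THEN iffD1, THEN conjunct2, rule_format]

lemma clinear_form_eqI:
  assumes "clinear_form f" "clinear_form g" "\<And>i. f (gen i) = g (gen i)"
  shows "f x = g x"
  by (induction x rule: sv_induct)
    (simp_all add: assms(3) clinear_form_simps[OF assms(1)] clinear_form_simps[OF assms(2)])

lemma cbilinear_form_left: "cbilinear_form \<psi> \<Longrightarrow> clinear_form (\<lambda>x. \<psi> x y)"
  and cbilinear_form_right: "cbilinear_form \<psi> \<Longrightarrow> clinear_form (\<psi> x)"
  by (simp_all add: cbilinear_form_def)

lemmas cbilinear_form_simps =
  clinear_form_simps[OF cbilinear_form_left] clinear_form_simps[OF cbilinear_form_right]

lemma cbilinear_form_eqI: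
  assumes "cbilinear_form \<psi>" "cbilinear_form \<phi>"
    and gen: "\<And>i j. \<psi> (gen i) (gen j) = \<phi> (gen i) (gen j)"
  shows "\<psi> = \<phi>"
proof (intro ext)
  fix x y
  have "\<psi> (gen i) y = \<phi> (gen i) y" for i
    using clinear_form_eqI[OF cbilinear_form_right cbilinear_form_right, OF assms(1,2)] gen by blast
  then show "\<psi> x y = \<phi> x y"
    using clinear_form_eqI[OF cbilinear_form_left cbilinear_form_left, OF assms(1,2)] by blast
qed

section \<open>Cocycles of the form f([x, y]), and a test for cocycles on the basis\<close>

lemma cbilinear_form_bracket:
  assumes "clinear_form f"
  shows "cbilinear_form (\<lambda>x y. f (bracket x y))"
  using assms by (simp add: cbilinear_form_def clinear_form_iff bracket_add_left bracket_add_right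
      bracket_scale_left bracket_scale_right)

lemma bracket_skew: "bracket x y = - bracket y (x :: 'a::complex_lie_algebra)"
proof -
  have "bracket (x + y) (x + y) = bracket (x + y) x + bracket (x + y) y"
    by (rule bracket_add_right)
  also have "\<dots> = bracket x y + bracket y x"
    by (simp add: bracket_add_left bracket_self add.commute)
  finally have "bracket (x + y) (x + y) = bracket x y + bracket y x" .
  then show ?thesis
    using bracket_self[of "x + y"] by (metis add_eq_0_iff2)
qed

lemma cocycle2_bracket:
  assumes "clinear_form f"
  shows "cocycle2 (\<lambda>x y. f (bracket x y))"
  unfolding cocycle2_def
proof (intro conjI allI cbilinear_form_bracket[OF assms])
  show "f (bracket x y) = - f (bracket y x)" for x y
    by (subst bracket_skew) (simp add: clinear_form_minus[OF assms])
  show "f (bracket (bracket x y) z) + f (bracket (bracket y z) x) + f (bracket (bracket z x) y) = 0"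
    for x y z
    using jacobi[of x y z] clinear_form_zero[OF assms] assms by (metis clinear_form_iff)
qed

definition bilinear_ext :: "(sv_index \<Rightarrow> sv_index \<Rightarrow> complex) \<Rightarrow> sv \<Rightarrow> sv \<Rightarrow> complex"
  where "bilinear_ext g x y = form_ext (\<lambda>i. form_ext (g i) y) x"

lemma bilinear_ext_gen: "bilinear_ext g (gen i) (gen j) = g i j"
  by (simp add: bilinear_ext_def form_ext_gen)

lemma cbilinear_form_ext: "cbilinear_form (bilinear_ext g)"
  by (simp add: cbilinear_form_def clinear_form_iff bilinear_ext_def form_ext_add form_ext_scale
      form_ext_fun_add form_ext_fun_scale)

text \<open>Antisymmetry is an equality of two bilinear forms and the cyclic sum is linear in each
  argument, so both extend from the basis to all of \<open>sv\<close>, the cyclic sum one argument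
  at a time.\<close>

lemma cocycle2_genI:
  fixes \<psi> :: "sv \<Rightarrow> sv \<Rightarrow> complex"
  assumes bil: "cbilinear_form \<psi>"
    and skew: "\<And>i j. \<psi> (gen i) (gen j) = - \<psi> (gen j) (gen i)"
    and cyc: "\<And>i j k. \<psi> (bracket_gen i j) (gen k) + \<psi> (bracket_gen j k) (gen i)
      + \<psi> (bracket_gen k i) (gen j) = 0"
  shows "cocycle2 \<psi>"
proof -
  note lin = cbilinear_form_simps[OF bil]
  have bil': "cbilinear_form (\<lambda>x y. - \<psi> y x)"
    by (simp add: cbilinear_form_def clinear_form_iff lin)
  have "\<psi> = (\<lambda>x y. - \<psi> y x)"
    using bil bil' skew by (rule cbilinear_form_eqI)
  then have skew': "\<psi> x y = - \<psi> y x" for x y by metis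
  define J where "J x y z = \<psi> (bracket x y) z + \<psi> (bracket y z) x + \<psi> (bracket z x) y" for x y z
  note [simp] = lin bracket_add_left bracket_add_right bracket_scale_left bracket_scale_right
  have J1: "clinear_form (\<lambda>x. J x y z)" and J2: "clinear_form (\<lambda>y. J x y z)"
    and J3: "clinear_form (\<lambda>z. J x y z)" for x y z
    by (simp_all add: J_def clinear_form_iff algebra_simps)
  have zero: "clinear_form (\<lambda>x::sv. 0)" by (simp add: clinear_form_iff)
  have "J (gen i) (gen j) (gen k) = 0" for i j k
    using cyc by (simp add: J_def bracket_gen_gen)
  then have "J (gen i) (gen j) z = 0" for i j z
    using clinear_form_eqI[OF J3 zero] by blast
  then have "J (gen i) y z = 0" for i y z
    using clinear_form_eqI[OF J2 zero] by blast
  then have "J x y z = 0" for x y z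
    using clinear_form_eqI[OF J1 zero] by blast
  then show ?thesis
    using bil skew' unfolding cocycle2_def J_def by blast
qed

section \<open>The three basic cocycles\<close>

text \<open>The \<open>a\<close> part is the Virasoro cocycle up to a coboundary (m^3 in place of
  m^3 - m), the \<open>c\<close> part the Heisenberg cocycle on the \<open>N m\<close>, and the
  \<open>b\<close> part the mixed cocycle of the twisted Heisenberg-Virasoro algebra.\<close>

fun omega_gen :: "complex \<Rightarrow> complex \<Rightarrow> complex \<Rightarrow> sv_index \<Rightarrow> sv_index \<Rightarrow> complex" where
  "omega_gen a b c (L m) (L n) = (if n = - m then a * of_int m ^ 3 else 0)"
| "omega_gen a b c (L m) (N n) = (if n = - m then b * of_int m ^ 2 else 0)"
| "omega_gen a b c (N m) (L n) = (if n = - m then - b * of_int m ^ 2 else 0)"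
| "omega_gen a b c (N m) (N n) = (if n = - m then c * of_int m else 0)"
| "omega_gen a b c _ _ = 0"

definition omega :: "complex \<Rightarrow> complex \<Rightarrow> complex \<Rightarrow> sv \<Rightarrow> sv \<Rightarrow> complex"
  where "omega a b c = bilinear_ext (omega_gen a b c)"

lemma omega_simps: "omega a b c (gen i) (gen j) = omega_gen a b c i j"
  by (simp add: omega_def bilinear_ext_gen)

lemma cbilinear_omega: "cbilinear_form (omega a b c)"
  by (simp add: omega_def cbilinear_form_ext)

lemma omega_gen_skew: "omega_gen a b c i j = - omega_gen a b c j i"
  by (cases i; cases j) auto

lemma cocycle2_omega: "cocycle2 (omega a b c)"
proof (rule cocycle2_genI[OF cbilinear_omega])
  show "omega a b c (gen i) (gen j) = - omega a b c (gen j) (gen i)" for i j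
    unfolding omega_simps by (rule omega_gen_skew)
  note [simp] = cbilinear_form_simps[OF cbilinear_omega] omega_simps
  show "omega a b c (bracket_gen i j) (gen k) + omega a b c (bracket_gen j k) (gen i)
      + omega a b c (bracket_gen k i) (gen j) = 0" for i j k
    \<comment> \<open>Only triples of \<open>L\<close> and \<open>N\<close> generators with index
      sum 0 can contribute; for these the claim is a polynomial identity in two indices.\<close>
    by (cases i; cases j; cases k; simp)
      (auto; simp add: algebra_simps power2_eq_square power3_eq_cube)+
qed

section \<open>The classes of the basic cocycles and their independence\<close>

lemma cohomologous2_omega_refl: "cohomologous2 (omega a b c) (omega a b c)"
  by (simp add: cohomologous2_def cocycle2_omega coboundary2_zero)

lift_definition omega_class :: "complex \<Rightarrow> complex \<Rightarrow> complex \<Rightarrow> sv H2" is omega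
  by (rule cohomologous2_omega_refl)

lemma omega_combination:
  "omega (r * a + s * a') (r * b + s * b') (r * c + s * c')
    = (\<lambda>x y. r * omega a b c x y + s * omega a' b' c' x y)"
proof (rule cbilinear_form_eqI[OF cbilinear_omega])
  show "cbilinear_form (\<lambda>x y. r * omega a b c x y + s * omega a' b' c' x y)"
    using cocycle2_combination[OF cocycle2_omega cocycle2_omega] unfolding cocycle2_def by blast
  show "omega (r * a + s * a') (r * b + s * b') (r * c + s * c') (gen i) (gen j)
      = r * omega a b c (gen i) (gen j) + s * omega a' b' c' (gen i) (gen j)" for i j
    by (cases i; cases j) (simp_all add: omega_simps algebra_simps)
qed

lemma omega_add:
  "(\<lambda>x y. omega a b c x y + omega a' b' c' x y) = omega (a + a') (b + b') (c + c')"
  using omega_combination[of 1 a 1 a' b b' c c'] by simp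

lemma omega_scale: "(\<lambda>x y. r * omega a b c x y) = omega (r * a) (r * b) (r * c)"
  using omega_combination[of r a 0 a b b c c] by simp

lemma omega_class_add:
  "omega_class a b c + omega_class a' b' c' = omega_class (a + a') (b + b') (c + c')"
  by transfer (simp add: omega_add cohomologous2_omega_refl)

lemma omega_class_scale: "r *\<^sub>C omega_class a b c = omega_class (r * a) (r * b) (r * c)"
  by transfer (simp add: omega_scale cohomologous2_omega_refl)

text \<open>A coboundary is linear in m on the pairs (L m, L (-m)) and (L m, N (-m)) and vanishes on
  (N m, N (-m)); nonzero values a m^3, b m^2, c m conflict with this.\<close>

lemma coboundary2_omega_iff: "coboundary2 (omega a b c) \<longleftrightarrow> a = 0 \<and> b = 0 \<and> c = 0"
proof
  assume "coboundary2 (omega a b c)"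
  then obtain f where f: "clinear_form f" and eq: "omega a b c = (\<lambda>x y. f (bracket x y))"
    by (auto simp: coboundary2_def)
  have gen: "omega_gen a b c i j = f (bracket_gen i j)" for i j
    using eq by (metis omega_simps bracket_gen_gen)
  note [simp] = clinear_form_simps[OF f]
  have "c = 0" using gen[of "N 1" "N (-1)"] by simp
  \<comment> \<open>The two brackets are \<open>- gen (N 0)\<close> and \<open>gen (N 0)\<close>,
    whereas \<open>omega\<close> takes the value b on both pairs.\<close>
  moreover have "b = 0"
    using gen[of "L 1" "N (-1)"] gen[of "L (-1)" "N 1"] by simp
  \<comment> \<open>The brackets are -2 and -4 times \<open>gen (L 0)\<close>, so the second value
    is twice the first; but the values are a and 8a.\<close>
  moreover have "a = 0"
    using gen[of "L 1" "L (-1)"] gen[of "L 2" "L (-2)"] by simp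
  ultimately show "a = 0 \<and> b = 0 \<and> c = 0" by simp
next
  have "omega 0 0 0 = (\<lambda>x y. 0)"
    using omega_combination[of 0 0 0 0 0 0 0 0] by simp
  moreover assume "a = 0 \<and> b = 0 \<and> c = 0"
  ultimately show "coboundary2 (omega a b c)"
    by (simp add: coboundary2_zero)
qed

lemma omega_class_eq_0_iff: "omega_class a b c = 0 \<longleftrightarrow> a = 0 \<and> b = 0 \<and> c = 0"
  using coboundary2_omega_iff
  by transfer (simp add: cohomologous2_def cocycle2_omega cocycle2_zero)

section \<open>The recurrences for cocycle values\<close>

text \<open>Both n^2 and n solve the recurrence. Subtracting the combination that agrees with
  \<open>d\<close> at 1 and 2 leaves a solution \<open>e\<close> vanishing there, and the recurrence
  spreads this zero to every integer.\<close>

lemma quadratic_recurrence: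
  fixes d :: "int \<Rightarrow> complex"
  assumes rec: "\<And>m n. of_int (m - n) * d (m + n) = of_int (m + n) * (d m - d n)"
  shows "d n = (d 2 - 2 * d 1) / 2 * of_int n ^ 2 + (4 * d 1 - d 2) / 2 * of_int n"
proof -
  define \<alpha> \<beta> where "\<alpha> = (d 2 - 2 * d 1) / 2" and "\<beta> = (4 * d 1 - d 2) / 2"
  define e where "e n = d n - (\<alpha> * of_int n ^ 2 + \<beta> * of_int n)" for n
  have e_rec: "of_int (m - n) * e (m + n) = of_int (m + n) * (e m - e n)" for m n
    using rec[of m n] by (simp add: e_def algebra_simps power2_eq_square)
  have e1: "e 1 = 0" and e2: "e 2 = 0"
    by (simp_all add: e_def \<alpha>_def \<beta>_def field_simps)
  have e0: "e 0 = 0" using e_rec[of 0 1] e1 by simp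
  \<comment> \<open>The downward induction has the factor i, which vanishes at 0, so it starts at
    -1; this value comes from the pair (-1, 2), whose sum is 1.\<close>
  have em1: "e (-1) = 0" using e_rec[of "-1" 2] e1 e2 by simp
  \<comment> \<open>The factor i - 1 vanishes at i = 1, which is why the value at 2 has to be
    matched in advance.\<close>
  have pos: "e n = 0" if "n \<ge> 2" for n
    using that
  proof (induction n rule: int_ge_induct)
    case (step i)
    have "of_int (i - 1) * e (i + 1) = 0" using e_rec[of i 1] e1 step by simp
    then show ?case using step.hyps by (simp only: mult_eq_0_iff of_int_eq_0_iff) linarith
  qed (simp add: e2)
  have neg: "e n = 0" if "n \<le> -1" for n
    using that
  proof (induction n rule: int_le_induct)
    case (step i)
    have "of_int i * e (i - 1) = 0" using e_rec[of "i - 1" 1] e1 step by simp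
    then show ?case using step.hyps by (simp only: mult_eq_0_iff of_int_eq_0_iff) linarith
  qed (simp add: em1)
  have "n \<ge> 2 \<or> n \<le> -1 \<or> n = 0 \<or> n = 1" by linarith
  then have "e n = 0" using pos neg e0 e1 by blast
  then show ?thesis by (simp add: e_def \<alpha>_def \<beta>_def)
qed

text \<open>The same argument with the solutions n^3 and n. Oddness settles 0 and the negative
  integers, so only the upward induction is needed.\<close>

lemma cubic_recurrence:
  fixes d :: "int \<Rightarrow> complex"
  assumes odd: "\<And>n. d (- n) = - d n"
    and rec: "\<And>m n. of_int (m - n) * d (m + n) = of_int (m + 2 * n) * d m - of_int (2 * m + n) * d n"
  shows "d n = (d 2 - 2 * d 1) / 6 * of_int n ^ 3 + (8 * d 1 - d 2) / 6 * of_int n"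
proof -
  define \<alpha> \<beta> where "\<alpha> = (d 2 - 2 * d 1) / 6" and "\<beta> = (8 * d 1 - d 2) / 6"
  define e where "e n = d n - (\<alpha> * of_int n ^ 3 + \<beta> * of_int n)" for n
  have e_rec: "of_int (m - n) * e (m + n) = of_int (m + 2 * n) * e m - of_int (2 * m + n) * e n"
    for m n
    using rec[of m n] by (simp add: e_def algebra_simps power3_eq_cube)
  have e1: "e 1 = 0" and e2: "e 2 = 0"
    by (simp_all add: e_def \<alpha>_def \<beta>_def field_simps)
  have e0: "e 0 = 0" using odd[of 0] by (simp add: e_def)
  have pos: "e n = 0" if "n \<ge> 2" for n
    using that
  proof (induction n rule: int_ge_induct)
    case (step i)
    have "of_int (i - 1) * e (i + 1) = 0" using e_rec[of i 1] e1 step by simp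
    then show ?case using step.hyps by (simp only: mult_eq_0_iff of_int_eq_0_iff) linarith
  qed (simp add: e2)
  have e_odd: "e (- n) = - e n" for n
    by (simp add: e_def odd)
  have "n \<ge> 2 \<or> n = 1 \<or> n = 0 \<or> n = - 1 \<or> - n \<ge> 2" by linarith
  then have "e n = 0" using pos e_odd e0 e1 by (metis minus_minus neg_equal_0_iff_equal)
  then show ?thesis by (simp add: e_def \<alpha>_def \<beta>_def)
qed

section \<open>Normal form of a cocycle\<close>

fun N_weight :: "sv_index \<Rightarrow> complex" where
  "N_weight (L n) = 0" | "N_weight (M n) = 2" | "N_weight (N n) = 0" | "N_weight (Y n) = 1"

text \<open>Eigenvalues of ad (L 0); the shift by 1/2 reflects that \<open>Y n\<close> stands for
  the basis vector of index n + 1/2.\<close>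

fun L_weight :: "sv_index \<Rightarrow> complex" where
  "L_weight (L n) = of_int n" | "L_weight (M n) = of_int n" | "L_weight (N n) = of_int n"
| "L_weight (Y n) = of_int n + 1 / 2"

text \<open>In the cocycle identity for d, x, y, two terms are v and w times \<psi>(x, y), because x
  and y are eigenvectors of ad d.\<close>

lemma cocycle2_weight:
  assumes coc: "cocycle2 \<psi>" and "bracket d x = v *\<^sub>C x" and "bracket d y = w *\<^sub>C y"
  shows "(v + w) * \<psi> x y = \<psi> d (bracket x y)"
proof -
  have bil: "cbilinear_form \<psi>" and skew: "\<And>x y. \<psi> x y = - \<psi> y x"
    and cyc: "\<psi> (bracket d x) y + \<psi> (bracket x y) d + \<psi> (bracket y d) x = 0"
    using coc unfolding cocycle2_def by blast+
  have "\<psi> (bracket y d) x = w * \<psi> x y"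
    using assms(3) bracket_skew[of y d] skew[of y x] by (simp add: cbilinear_form_simps[OF bil])
  then show ?thesis
    using cyc assms(2) skew[of "bracket x y" d]
    by (simp add: cbilinear_form_simps[OF bil] algebra_simps)
qed

lemma bracket_N_weight: "bracket (gen (N 0)) (gen i) = N_weight i *\<^sub>C gen i"
  by (cases i) (simp_all add: bracket_gen_gen complex_vector.scale_one)

lemma bracket_L_weight: "bracket (gen (L 0)) (gen i) = L_weight i *\<^sub>C gen i"
  by (cases i) (simp_all add: bracket_gen_gen)

lemma cocycle2_normal_form:
  fixes \<psi> :: "sv \<Rightarrow> sv \<Rightarrow> complex"
  assumes coc: "cocycle2 \<psi>"
  shows "\<exists>a b c f. clinear_form f \<and> \<psi> = (\<lambda>x y. omega a b c x y + f (bracket x y))"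
proof -
  have bil: "cbilinear_form \<psi>" and skew: "\<And>x y. \<psi> x y = - \<psi> y x"
    and cyc: "\<And>x y z. \<psi> (bracket x y) z + \<psi> (bracket y z) x + \<psi> (bracket z x) y = 0"
    using coc unfolding cocycle2_def by blast+
  note lin = cbilinear_form_simps[OF bil]
  define p where "p i j = \<psi> (gen i) (gen j)" for i j
  have p_skew: "p i j = - p j i" for i j unfolding p_def by (rule skew)
  have cyc_gen: "\<psi> (bracket_gen i j) (gen k) + \<psi> (bracket_gen j k) (gen i)
      + \<psi> (bracket_gen k i) (gen j) = 0" for i j k
    using cyc[of "gen i" "gen j" "gen k"] by (simp add: bracket_gen_gen)
  define A B C where "A n = p (L n) (L (- n))" and "B n = p (L n) (N (- n))"
    and "C n = p (N n) (N (- n))" for n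
  define a a' where "a = (A 2 - 2 * A 1) / 6" and "a' = (8 * A 1 - A 2) / 6"
  define b b' where "b = (B 2 - 2 * B 1) / 2" and "b' = (4 * B 1 - B 2) / 2"
  have A: "A n = a * of_int n ^ 3 + a' * of_int n" for n
    unfolding a_def a'_def
  proof (rule cubic_recurrence)
    show A_odd: "A (- n) = - A n" for n
      unfolding A_def minus_minus by (rule p_skew)
    show "of_int (m - n) * A (m + n) = of_int (m + 2 * n) * A m - of_int (2 * m + n) * A n" for m n
      \<comment> \<open>The indices sum to 0, so every term is a value of \<open>A\<close>, at m +
        n, -m or -n; oddness removes the signs.\<close>
      using cyc_gen[of "L m" "L n" "L (- m - n)"] A_odd[of m] A_odd[of n]
      by (simp add: lin p_def[symmetric] A_def) (simp add: algebra_simps)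
  qed
  have B: "B n = b * of_int n ^ 2 + b' * of_int n" for n
    unfolding b_def b'_def
  proof (rule quadratic_recurrence)
    show "of_int (m - n) * B (m + n) = of_int (m + n) * (B m - B n)" for m n
      using cyc_gen[of "L m" "L n" "N (- m - n)"] p_skew[of "N (-n)" "L n"] p_skew[of "N (-m)" "L m"]
      by (simp add: lin p_def[symmetric] B_def) (simp add: algebra_simps)
  qed
  have C: "C n = C 1 * of_int n" for n
    \<comment> \<open>Since [N n, N 1] = 0, only two terms remain, and they give C n = n C 1 without
      an induction.\<close>
    using cyc_gen[of "L (- n - 1)" "N n" "N 1"] p_skew[of "N (-n)" "N n"] p_skew[of "N (-1)" "N 1"]
    by (simp add: lin p_def[symmetric] C_def)
  \<comment> \<open>Dividing by a nonzero weight makes f([x, y]) reproduce \<psi>. Both weights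
    vanish only at \<open>L 0\<close> and \<open>N 0\<close>; there [L n, L (-n)] = -2n L 0 and
    [L n, N (-n)] = -n N 0 dictate -a'/2 and -b', so that f yields the linear terms a' n and b'
    n.\<close>
  define F where "F i = (if N_weight i \<noteq> 0 then p (N 0) i / N_weight i
    else if L_weight i \<noteq> 0 then p (L 0) i / L_weight i
    else case i of L _ \<Rightarrow> - a' / 2 | _ \<Rightarrow> - b')" for i
  define f where "f = form_ext F"
  have f: "clinear_form f" by (simp add: f_def clinear_form_ext)
  have f_gen: "f (gen i) = F i" for i by (simp add: f_def form_ext_gen)
  note [simp] = clinear_form_simps[OF f] f_gen
  have N_w: "(N_weight i + N_weight j) * p i j = \<psi> (gen (N 0)) (bracket_gen i j)" for i j
    using cocycle2_weight[OF coc bracket_N_weight bracket_N_weight]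
    by (simp add: p_def bracket_gen_gen)
  have L_w: "(L_weight i + L_weight j) * p i j = \<psi> (gen (L 0)) (bracket_gen i j)" for i j
    using cocycle2_weight[OF coc bracket_L_weight bracket_L_weight]
    by (simp add: p_def bracket_gen_gen)
  let ?w = "omega_gen a b (C 1)"
  have gen: "p i j = ?w i j + f (bracket_gen i j)" for i j
  proof -
    consider "N_weight i + N_weight j \<noteq> 0"
      | "N_weight i + N_weight j = 0" "L_weight i + L_weight j \<noteq> 0"
      | "N_weight i + N_weight j = 0" "L_weight i + L_weight j = 0" by blast
    then show ?thesis
    proof cases
      case 1
      \<comment> \<open>The bracket is 0 or a multiple of one generator whose weight is the sum of
        the two weights, so the division in \<open>F\<close> cancels.\<close>
      then have "\<psi> (gen (N 0)) (bracket_gen i j) = (N_weight i + N_weight j) * f (bracket_gen i j)"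
        by (cases i; cases j) (simp_all add: lin p_def[symmetric] F_def)
      moreover have "?w i j = 0" using 1 by (cases i; cases j) simp_all
      ultimately show ?thesis using N_w[of i j] 1 by simp
    next
      case 2
      then have "\<psi> (gen (L 0)) (bracket_gen i j) = (L_weight i + L_weight j) * f (bracket_gen i j)"
        by (cases i; cases j)
          (simp_all add: lin p_def[symmetric] F_def add_eq_0_iff add.commute flip: of_int_add)
      moreover have "?w i j = 0" using 2 by (cases i; cases j) auto
      ultimately show ?thesis using L_w[of i j] 2 by simp
    next
      case 3
      have zero: "n = - m" if "of_int m + of_int n = (0 :: complex)" for m n
        using that by (simp add: add_eq_0_iff flip: of_int_minus)
      show ?thesis
      \<comment> \<open>The N-weights are 0, 1 or 2, so a zero sum leaves only \<open>L\<close> and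
        \<open>N\<close>; every other pair contradicts the case assumption.\<close>
      proof (cases i; cases j)
        fix m n assume ij: "i = L m" "j = L n"
        with 3 zero have "n = - m" by simp
        then show ?thesis using A[of m] ij by (simp add: A_def[symmetric] F_def algebra_simps)
      next
        fix m n assume ij: "i = L m" "j = N n"
        with 3 zero have "n = - m" by simp
        then show ?thesis using B[of m] ij by (simp add: B_def[symmetric] F_def algebra_simps)
      next
        fix m n assume ij: "i = N m" "j = L n"
        with 3 zero have "m = - n" by (simp add: add.commute)
        then show ?thesis using B[of n] ij p_skew[of i j]
          by (simp add: B_def[symmetric] F_def algebra_simps)
      next
        fix m n assume ij: "i = N m" "j = N n"
        with 3 zero have "n = - m" by simp
        then show ?thesis using C[of m] ij by (simp add: C_def[symmetric])
      qed (use 3 in simp_all)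
    qed
  qed
  have "\<psi> = (\<lambda>x y. omega a b (C 1) x y + f (bracket x y))"
  proof (rule cbilinear_form_eqI[OF bil])
    show "cbilinear_form (\<lambda>x y. omega a b (C 1) x y
        + f (bracket x y))"
      using cocycle2_combination[OF cocycle2_omega cocycle2_bracket[OF f], of 1 _ _ _ 1]
      unfolding cocycle2_def mult_1_left by blast
  qed (use gen in \<open>simp add: p_def omega_simps bracket_gen_gen\<close>)
  then show ?thesis using f by blast
qed

section \<open>Spanning classes and the dimension\<close>

lemma omega_class_surj: "\<exists>a b c. x = omega_class a b c"
proof (transfer)
  fix \<psi> :: "sv \<Rightarrow> sv \<Rightarrow> complex"
  assume "cohomologous2 \<psi> \<psi>"
  then have coc: "cocycle2 \<psi>" by (simp add: cohomologous2_def)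
  then obtain a b c f where f: "clinear_form f"
    and eq: "\<psi> = (\<lambda>x y. omega a b c x y + f (bracket x y))"
    using cocycle2_normal_form by blast
  have "coboundary2 (\<lambda>x y. \<psi> x y - omega a b c x y)"
    using f cocycle2_bracket[OF f] by (auto simp: eq coboundary2_def)
  then show "\<exists>a b c. cohomologous2 \<psi> (omega a b c)"
    using coc cocycle2_omega by (auto simp: cohomologous2_def)
qed

theorem theorem3p1: "complex_vector.dim (UNIV :: sv H2 set) = 3"
proof (rule complex_vector.dim_unique)
  let ?e1 = "omega_class 1 0 0" and ?e2 = "omega_class 0 1 0" and ?e3 = "omega_class 0 0 1"
  let ?B = "{?e1, ?e2, ?e3}"
  have comb: "a *\<^sub>C ?e1 + b *\<^sub>C ?e2 + c *\<^sub>C ?e3 = omega_class a b c" for a b c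
    by (simp add: omega_class_add omega_class_scale)
  have "omega_class a b c - omega_class a' b' c' = omega_class (a - a') (b - b') (c - c')"
    for a b c a' b' c'
    by (simp add: omega_class_add algebra_simps)
  \<comment> \<open>Injectivity in the parameters makes the three classes distinct; this gives the
    cardinality and lets a sum over the set \<open>?B\<close> split into three terms.\<close>
  then have eq_iff: "omega_class a b c = omega_class a' b' c' \<longleftrightarrow> a = a' \<and> b = b' \<and> c = c'"
    for a b c a' b' c'
    by (metis omega_class_eq_0_iff right_minus_eq)
  show "card ?B = 3" by (simp add: eq_iff)
  show "complex_vector.independent ?B"
  proof
    assume "complex_vector.dependent ?B"
    then obtain u where "\<exists>v\<in>?B. u v \<noteq> 0" and "(\<Sum>v\<in>?B. u v *\<^sub>C v) = 0"
      by (auto simp only: complex_vector.dependent_finite finite.intros)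
    moreover have "(\<Sum>v\<in>?B. u v *\<^sub>C v) = omega_class (u ?e1) (u ?e2) (u ?e3)"
      by (simp add: eq_iff comb add.assoc[symmetric])
    ultimately show False by (auto simp: omega_class_eq_0_iff)
  qed
  show "UNIV \<subseteq> complex_vector.span ?B"
  proof
    fix x :: "sv H2"
    obtain a b c where x: "x = omega_class a b c" using omega_class_surj by blast
    have "a *\<^sub>C ?e1 + b *\<^sub>C ?e2 + c *\<^sub>C ?e3 \<in> complex_vector.span ?B"
      by (intro complex_vector.span_add complex_vector.span_scale complex_vector.span_base) simp_all
    then show "x \<in> complex_vector.span ?B"
      by (simp only: x comb)
  qed
qed simp

end
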